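(* Let $\nu>-1$. Let $\alpha_{\nu,n}$ denote the $n$th positive zero of the Dini function $d_\nu$ and $\gamma_{\nu,n}$ the $n$th positive zero of the cross-product $W_\nu$. Then $$\alpha_{\nu,n}<\gamma_{\nu,n}<\alpha_{\nu,n+1}\qquad\text{for all } n\in\mathbb{N}.$$
   Context: $J_\nu$ and $I_\nu$ are the Bessel and modified Bessel functions of the first kind; $\mathbb{N}=\{1,2,\dots\}$. The Dini function is $d_\nu(z)=(1-\nu)J_\nu(z)+zJ_\nu'(z)=J_\nu(z)-zJ_{\nu+1}(z)$. The cross-product is $W_\nu(z)=J_\nu(z)I_\nu'(z)-J_\nu'(z)I_\nu(z)=J_{\nu+1}(z)I_\nu(z)+J_\nu(z)I_{\nu+1}(z)$. Positive zeros are listed in increasing order. *)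

theory Defs
  imports "HOL-Analysis.Analysis"
begin

text \<open>
  Only positive arguments matter below, so the Bessel functions are taken on the real line,
  where \<open>powr\<close> is the intended real power for \<open>z > 0\<close>. The reciprocal Gamma function makes
  the series correct for every real order.
\<close>

definition bessel_J :: "real \<Rightarrow> real \<Rightarrow> real" where
  "bessel_J \<nu> z = (\<Sum>k. (-1) ^ k * rGamma (\<nu> + real k + 1) / fact k * (z / 2) powr (2 * real k + \<nu>))"

definition bessel_I :: "real \<Rightarrow> real \<Rightarrow> real" where
  "bessel_I \<nu> z = (\<Sum>k. rGamma (\<nu> + real k + 1) / fact k * (z / 2) powr (2 * real k + \<nu>))"

definition dini :: "real \<Rightarrow> real \<Rightarrow> real" where
  "dini \<nu> z = (1 - \<nu>) * bessel_J \<nu> z + z * deriv (bessel_J \<nu>) z"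

definition cross_W :: "real \<Rightarrow> real \<Rightarrow> real" where
  "cross_W \<nu> z = bessel_J \<nu> z * deriv (bessel_I \<nu>) z - deriv (bessel_J \<nu>) z * bessel_I \<nu> z"

text \<open>
  The \<open>n\<close>-th positive zero in increasing order, counted from \<open>n = 1\<close>: the zero \<open>x\<close> with exactly
  \<open>n\<close> zeros in \<open>(0, x]\<close>. There is at most one such \<open>x\<close>; when there is none, the value is
  unspecified but independent of \<open>f\<close> and \<open>n\<close>. Hence strict inequalities
  \<open>pos_zero f n < pos_zero g n < pos_zero f (n + 1)\<close> for all \<open>n \<ge> 1\<close> can only hold
  if all these zeros exist.
\<close>

definition pos_zero :: "(real \<Rightarrow> real) \<Rightarrow> nat \<Rightarrow> real" where
  "pos_zero f n = (THE x. 0 < x \<and> f x = 0 \<and>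
     finite {y. 0 < y \<and> y \<le> x \<and> f y = 0} \<and> card {y. 0 < y \<and> y \<le> x \<and> f y = 0} = n)"

end

theory Submission
  imports Defs
begin

text \<open>
  Put \<open>t = z\<^sup>2 / 4\<close>, let \<open>C\<^sub>\<nu>\<close> be the Bessel--Clifford function, so that \<open>C\<^sub>\<nu>(-t)\<close> and \<open>C\<^sub>\<nu>(t)\<close> are
  \<open>J\<^sub>\<nu>(z)\<close> and \<open>I\<^sub>\<nu>(z)\<close> divided by \<open>(z / 2)\<^sup>\<nu>\<close>, and let \<open>p(t) = z J\<^sub>\<nu>\<^sub>+\<^sub>1(z) / (2 J\<^sub>\<nu>(z))\<close>.
  The derivative of \<open>p\<close> is a positive multiple of a Turan expression, whose product with
  \<open>t\<^sup>\<nu>\<^sup>+\<^sup>1\<close> vanishes at \<open>0\<close> and has derivative \<open>t\<^sup>\<nu> C\<^sub>\<nu>(-t)\<^sup>2\<close>; hence \<open>p\<close> increases strictly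
  between consecutive zeros of \<open>J\<^sub>\<nu>\<close>. The Dini function vanishes where \<open>p = 1/2\<close>, exactly
  once in each gap between consecutive zeros. Up to powers of \<open>t\<close>, the cross-product has
  derivative \<open>2 C\<^sub>\<nu>(-t) C\<^sub>\<nu>(t)\<close>, so it is monotone in each gap: it has no zero before the first
  zero of \<open>J\<^sub>\<nu>\<close> and exactly one in each later gap. There \<open>p < 0\<close>, so this zero precedes that
  of the Dini function in the same gap.
\<close>

section \<open>The Bessel--Clifford function: convergence, derivative, recurrence\<close>

definition clifford :: "real \<Rightarrow> real \<Rightarrow> real" where
  "clifford \<nu> t = (\<Sum>k. rGamma (\<nu> + real k + 1) / fact k * t ^ k)"

text \<open>Ratio test: consecutive terms have quotient
  \<open>t / ((k + 1) * (\<nu> + k + 1))\<close>, at most 1/2 in absolute value once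
  \<open>\<nu> + k + 1 > 2 * \<bar>t\<bar>\<close>.\<close>

lemma summable_clifford:
  "summable (\<lambda>k. rGamma (\<nu> + real k + 1) / fact k * t ^ k :: real)"
proof -
  obtain N :: nat where N: "real N > \<bar>\<nu>\<bar> + 2 * \<bar>t\<bar>"
    using reals_Archimedean2 by blast
  show ?thesis
  proof (rule summable_ratio_test[where c = "1/2" and N = N])
    fix k assume "N \<le> k"
    then have k: "\<nu> + real k + 1 > 2 * \<bar>t\<bar>" using N by linarith
    define x where "x = \<nu> + real k + 1"
    have x: "rGamma x = x * rGamma (x + 1)" by (simp add: rGamma_plus1)
    have "2 * \<bar>t\<bar> \<le> \<bar>x\<bar> * 1" using k unfolding x_def mult_1_right by linarith
    also have "\<dots> \<le> \<bar>x\<bar> * real (Suc k)" by (intro mult_left_mono) auto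
    finally have t: "\<bar>t\<bar> / real (Suc k) \<le> \<bar>x\<bar> / 2" by (simp add: field_simps del: of_nat_Suc)
    have "norm (rGamma (\<nu> + real (Suc k) + 1) / fact (Suc k) * t ^ Suc k)
        = \<bar>t\<bar> / real (Suc k) * (\<bar>rGamma (x + 1)\<bar> / fact k * \<bar>t\<bar> ^ k)"
    proof -
      have "\<nu> + real (Suc k) + 1 = x + 1" by (simp add: x_def)
      then show ?thesis by (simp only:) (simp add: abs_mult power_abs del: of_nat_Suc)
    qed
    also have "\<dots> \<le> \<bar>x\<bar> / 2 * (\<bar>rGamma (x + 1)\<bar> / fact k * \<bar>t\<bar> ^ k)"
      by (intro mult_right_mono t) simp
    also have "\<dots> = 1 / 2 * norm (rGamma (\<nu> + real k + 1) / fact k * t ^ k)"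
      unfolding x_def[symmetric] x by (simp add: abs_mult power_abs)
    finally show "norm (rGamma (\<nu> + real (Suc k) + 1) / fact (Suc k) * t ^ Suc k)
        \<le> 1 / 2 * norm (rGamma (\<nu> + real k + 1) / fact k * t ^ k)" .
  qed simp
qed

lemma DERIV_clifford: "(clifford \<nu> has_real_derivative clifford (\<nu> + 1) t) (at t)"
proof -
  have "diffs (\<lambda>k. rGamma (\<nu> + real k + 1) / fact k) k = rGamma (\<nu> + 1 + real k + 1) / fact k"
    for k :: nat
  proof -
    have "\<nu> + real (Suc k) + 1 = \<nu> + 1 + real k + 1" by simp
    then show ?thesis unfolding diffs_def by (simp only:) (simp del: of_nat_Suc)
  qed
  then have "clifford (\<nu> + 1) t = (\<Sum>k. diffs (\<lambda>k. rGamma (\<nu> + real k + 1) / fact k) k * t ^ k)"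
    by (simp add: clifford_def)
  with termdiffs_strong_converges_everywhere[OF summable_clifford]
  show ?thesis unfolding clifford_def by simp
qed

text \<open>Orders \<open>\<nu> + 1\<close> and \<open>\<nu> + 2\<close> are the first two
  derivatives of \<open>clifford \<nu>\<close>, so this is its differential equation.
  Coefficientwise it is the functional equation of \<open>rGamma\<close>, with the factor
  \<open>\<nu> + k + 1\<close> split into \<open>\<nu> + 1\<close> and \<open>k\<close>.\<close>

lemma clifford_rec: "clifford \<nu> t = (\<nu> + 1) * clifford (\<nu> + 1) t + t * clifford (\<nu> + 2) t"
proof -
  let ?c = "\<lambda>\<nu> k. rGamma (\<nu> + real k + 1) / fact k * t ^ k"
  have "(\<lambda>k. ?c (\<nu> + 1) k * (\<nu> + 1)) sums (clifford (\<nu> + 1) t * (\<nu> + 1))"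
    unfolding clifford_def by (intro sums_mult2 summable_sums summable_clifford)
  moreover have "(\<lambda>k. real k * ?c (\<nu> + 1) k) sums (t * clifford (\<nu> + 2) t)"
  proof -
    have "(\<lambda>k. t * ?c (\<nu> + 2) k) sums (t * clifford (\<nu> + 2) t)"
      unfolding clifford_def by (intro sums_mult summable_sums summable_clifford)
    moreover have "t * ?c (\<nu> + 2) k = real (Suc k) * ?c (\<nu> + 1) (Suc k)" for k
    proof -
      have "\<nu> + 1 + real (Suc k) + 1 = \<nu> + 2 + real k + 1" by simp
      then show ?thesis by (simp only:) (simp del: of_nat_Suc)
    qed
    ultimately have "(\<lambda>k. real (Suc k) * ?c (\<nu> + 1) (Suc k)) sums (t * clifford (\<nu> + 2) t)"
      by (simp only:)
    \<comment> \<open>The term of index 0 vanishes through its factor \<open>real k\<close>, so the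
      index shift leaves the sum unchanged.\<close>
    then show ?thesis
      using sums_Suc_iff[of "\<lambda>k. real k * ?c (\<nu> + 1) k"] by simp
  qed
  ultimately have "(\<lambda>k. ?c (\<nu> + 1) k * (\<nu> + 1) + real k * ?c (\<nu> + 1) k) sums
      (clifford (\<nu> + 1) t * (\<nu> + 1) + t * clifford (\<nu> + 2) t)"
    by (rule sums_add)
  moreover have "?c (\<nu> + 1) k * (\<nu> + 1) + real k * ?c (\<nu> + 1) k = ?c \<nu> k" for k
  proof -
    have "\<nu> + 1 + real k + 1 = \<nu> + real k + 1 + 1" by simp
    then have "?c (\<nu> + 1) k * (\<nu> + 1) + real k * ?c (\<nu> + 1) k =
        (\<nu> + real k + 1) * rGamma (\<nu> + real k + 1 + 1) * (t ^ k / fact k)"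
      by (simp only:) (simp add: algebra_simps add_divide_distrib)
    then show ?thesis unfolding rGamma_plus1 by simp
  qed
  ultimately show ?thesis
    by (simp add: clifford_def sums_iff mult.commute)
qed

lemma clifford_pos:
  assumes "\<nu> > -1" "t \<ge> 0"
  shows "clifford \<nu> t > 0"
proof -
  have r: "rGamma (\<nu> + real k + 1) > 0" for k
    using assms by (simp add: rGamma_inverse_Gamma Gamma_real_pos)
  show ?thesis
    unfolding clifford_def
    by (rule suminf_pos2[where i = 0, OF summable_clifford])
      (use assms r[of 0] less_imp_le[OF r] in auto)
qed

lemma DERIV_clifford_at_neg:
  "((\<lambda>t. clifford \<nu> (- t)) has_real_derivative - clifford (\<nu> + 1) (- t)) (at t)"
  using DERIV_chain2[OF DERIV_clifford, of uminus "- 1" t UNIV \<nu>]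
    DERIV_minus[OF DERIV_ident, of t UNIV] by simp

section \<open>Bessel functions, Dini function and cross-product in the variable t = z^2/4\<close>

lemma bessel_J_clifford:
  assumes "z > 0"
  shows "bessel_J \<nu> z = (z / 2) powr \<nu> * clifford \<nu> (- (z\<^sup>2 / 4))"
proof -
  have "(- 1) ^ k * rGamma (\<nu> + real k + 1) / fact k * (z / 2) powr (2 * real k + \<nu>) =
      (z / 2) powr \<nu> * (rGamma (\<nu> + real k + 1) / fact k * (- (z\<^sup>2 / 4)) ^ k)" for k
  proof -
    have "(z / 2) powr (2 * real k + \<nu>) = (z / 2) powr \<nu> * (z\<^sup>2 / 4) ^ k"
      using assms powr_realpow[of "z/2" "2*k"] by (simp add: powr_add power_mult power_divide)
    moreover have "(- (z\<^sup>2 / 4)) ^ k = (- 1) ^ k * (z\<^sup>2 / 4) ^ k"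
      by (rule power_minus)
    ultimately show ?thesis by simp
  qed
  then show ?thesis
    unfolding bessel_J_def clifford_def by (simp only: suminf_mult[OF summable_clifford])
qed

lemma bessel_I_clifford:
  assumes "z > 0"
  shows "bessel_I \<nu> z = (z / 2) powr \<nu> * clifford \<nu> (z\<^sup>2 / 4)"
proof -
  have "rGamma (\<nu> + real k + 1) / fact k * (z / 2) powr (2 * real k + \<nu>) =
      (z / 2) powr \<nu> * (rGamma (\<nu> + real k + 1) / fact k * (z\<^sup>2 / 4) ^ k)" for k
  proof -
    have "(z / 2) powr (2 * real k + \<nu>) = (z / 2) powr \<nu> * (z\<^sup>2 / 4) ^ k"
      using assms powr_realpow[of "z/2" "2*k"] by (simp add: powr_add power_mult power_divide)
    then show ?thesis by simp
  qed
  then show ?thesis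
    unfolding bessel_I_def clifford_def by (simp only: suminf_mult[OF summable_clifford])
qed

lemma deriv_bessel_J:
  assumes "z > 0"
  shows "deriv (bessel_J \<nu>) z = (z / 2) powr \<nu> *
    (\<nu> / z * clifford \<nu> (- (z\<^sup>2 / 4)) - z / 2 * clifford (\<nu> + 1) (- (z\<^sup>2 / 4)))"
proof (rule DERIV_imp_deriv)
  have "((\<lambda>z. (z / 2) powr \<nu> * clifford \<nu> (- (z\<^sup>2 / 4))) has_real_derivative
      (z / 2) powr \<nu> *
      (\<nu> / z * clifford \<nu> (- (z\<^sup>2 / 4)) - z / 2 * clifford (\<nu> + 1) (- (z\<^sup>2 / 4)))) (at z)"
    using assms
    by (auto intro!: derivative_eq_intros DERIV_chain2[OF DERIV_clifford]
        simp: field_simps powr_diff)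
  then show "(bessel_J \<nu> has_real_derivative (z / 2) powr \<nu> *
      (\<nu> / z * clifford \<nu> (- (z\<^sup>2 / 4)) - z / 2 * clifford (\<nu> + 1) (- (z\<^sup>2 / 4)))) (at z)"
    \<comment> \<open>The closed form is available for positive arguments; these form an open set,
      which suffices for the derivative.\<close>
    by (rule has_field_derivative_transform_within_open[where S = "{0<..}"])
      (use assms in \<open>auto simp: bessel_J_clifford\<close>)
qed

lemma deriv_bessel_I:
  assumes "z > 0"
  shows "deriv (bessel_I \<nu>) z = (z / 2) powr \<nu> *
    (\<nu> / z * clifford \<nu> (z\<^sup>2 / 4) + z / 2 * clifford (\<nu> + 1) (z\<^sup>2 / 4))"
proof (rule DERIV_imp_deriv)
  have "((\<lambda>z. (z / 2) powr \<nu> * clifford \<nu> (z\<^sup>2 / 4)) has_real_derivative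
      (z / 2) powr \<nu> *
      (\<nu> / z * clifford \<nu> (z\<^sup>2 / 4) + z / 2 * clifford (\<nu> + 1) (z\<^sup>2 / 4))) (at z)"
    using assms
    by (auto intro!: derivative_eq_intros DERIV_chain2[OF DERIV_clifford]
        simp: field_simps powr_diff)
  then show "(bessel_I \<nu> has_real_derivative (z / 2) powr \<nu> *
      (\<nu> / z * clifford \<nu> (z\<^sup>2 / 4) + z / 2 * clifford (\<nu> + 1) (z\<^sup>2 / 4))) (at z)"
    by (rule has_field_derivative_transform_within_open[where S = "{0<..}"])
      (use assms in \<open>auto simp: bessel_I_clifford\<close>)
qed

text \<open>\<open>dini_red\<close> and \<open>cross_red\<close> are \<open>dini\<close> and
  \<open>cross_W\<close> at t = z^2/4, divided by the positive factors (z/2)^\<nu> and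
  (z/2)^(2\<nu>+1). Unlike these they are continuous at the origin, which serves as the left end of
  the first gap.\<close>

definition dini_red :: "real \<Rightarrow> real \<Rightarrow> real" where
  "dini_red \<nu> t = clifford \<nu> (- t) - 2 * t * clifford (\<nu> + 1) (- t)"

definition cross_red :: "real \<Rightarrow> real \<Rightarrow> real" where
  "cross_red \<nu> t = clifford \<nu> (- t) * clifford (\<nu> + 1) t + clifford (\<nu> + 1) (- t) * clifford \<nu> t"

lemma dini_eq_0_iff:
  assumes "z > 0"
  shows "dini \<nu> z = 0 \<longleftrightarrow> dini_red \<nu> (z\<^sup>2 / 4) = 0"
proof -
  have "dini \<nu> z = (z / 2) powr \<nu> * dini_red \<nu> (z\<^sup>2 / 4)"
    unfolding dini_def dini_red_def deriv_bessel_J[OF assms] bessel_J_clifford[OF assms]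
    using assms by (simp add: field_simps power2_eq_square)
  then show ?thesis using assms by simp
qed

lemma cross_W_eq_0_iff:
  assumes "z > 0"
  shows "cross_W \<nu> z = 0 \<longleftrightarrow> cross_red \<nu> (z\<^sup>2 / 4) = 0"
proof -
  have "cross_W \<nu> z = ((z / 2) powr \<nu>)\<^sup>2 * (z / 2) * cross_red \<nu> (z\<^sup>2 / 4)"
    unfolding cross_W_def cross_red_def deriv_bessel_J[OF assms] bessel_J_clifford[OF assms]
      deriv_bessel_I[OF assms] bessel_I_clifford[OF assms]
    using assms by (simp add: field_simps power2_eq_square)
  moreover have "((z / 2) powr \<nu>)\<^sup>2 * (z / 2) \<noteq> 0"
    using assms by simp
  ultimately show ?thesis by (metis mult_eq_0_iff)
qed

section \<open>Derivative identities and positivity of the Turan expression\<close>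

lemma DERIV_mult_neg_clifford_Suc:
  "((\<lambda>t. t * clifford (\<nu> + 1) (- t)) has_real_derivative
     clifford \<nu> (- t) - \<nu> * clifford (\<nu> + 1) (- t)) (at t)"
proof -
  have d: "((\<lambda>t. clifford (\<nu> + 1) (- t)) has_real_derivative - clifford (\<nu> + 2) (- t)) (at t)"
    using DERIV_clifford_at_neg[of "\<nu> + 1" t] by (simp add: add.assoc)
  show ?thesis
    by (rule DERIV_cong[OF DERIV_mult[OF DERIV_ident d]])
      (use clifford_rec[of \<nu> "- t"] in \<open>simp add: algebra_simps\<close>)
qed

text \<open>This is the Turan expression \<open>J\<^sub>\<nu>\<^sup>2 - J\<^sub>\<nu>\<^sub>-\<^sub>1 J\<^sub>\<nu>\<^sub>+\<^sub>1\<close> up to a power of \<open>z\<close>.\<close>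

definition turan :: "real \<Rightarrow> real \<Rightarrow> real" where
  "turan \<nu> t = (clifford \<nu> (- t))\<^sup>2 - \<nu> * clifford \<nu> (- t) * clifford (\<nu> + 1) (- t)
     + t * (clifford (\<nu> + 1) (- t))\<^sup>2"

text \<open>Eliminating order \<open>\<nu> + 2\<close> by the recurrence makes orders
  \<open>\<nu>\<close> and \<open>\<nu> + 1\<close> a closed first-order linear system.\<close>

lemma DERIV_clifford_at_neg_Suc:
  assumes "t \<noteq> 0"
  shows "((\<lambda>t. clifford (\<nu> + 1) (- t)) has_real_derivative
      (clifford \<nu> (- t) - (\<nu> + 1) * clifford (\<nu> + 1) (- t)) / t) (at t)"
  using DERIV_clifford_at_neg[of "\<nu> + 1" t] clifford_rec[of \<nu> "- t"] assms
  by (simp add: add.assoc)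

lemma DERIV_powr_Suc:
  assumes "(t::real) > 0"
  shows "((\<lambda>t. t powr (\<nu> + 1)) has_real_derivative (\<nu> + 1) * t powr \<nu>) (at t)"
  using has_real_derivative_powr[OF assms, of "\<nu> + 1"] by simp

text \<open>The weight \<open>t powr (\<nu> + 1)\<close> acts as an integrating factor: under the
  first-order system everything but the square cancels.\<close>

lemma DERIV_powr_turan:
  assumes "t > 0"
  shows "((\<lambda>t. t powr (\<nu> + 1) * turan \<nu> t) has_real_derivative
    t powr \<nu> * (clifford \<nu> (- t))\<^sup>2) (at t)"
proof -
  \<comment> \<open>\<open>P\<close>, \<open>Q\<close>, \<open>Z\<close> and \<open>w\<close>
    abstract \<open>clifford \<nu> (- t)\<close>, \<open>clifford (\<nu> + 1) (- t)\<close>,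
    \<open>t powr (\<nu> + 1)\<close> and \<open>t powr \<nu>\<close>; what remains is
    algebra.\<close>
  have *: "((\<lambda>t. Z t * ((P t)\<^sup>2 - \<nu> * P t * Q t + t * (Q t)\<^sup>2)) has_real_derivative
      w * (P t)\<^sup>2) (at t)"
    if "(P has_real_derivative - Q t) (at t)"
      "(Q has_real_derivative (P t - (\<nu> + 1) * Q t) / t) (at t)"
      "(Z has_real_derivative (\<nu> + 1) * w) (at t)" "Z t = w * t" for P Q Z w
    using assms
    by (auto intro!: derivative_eq_intros that(1-3)
        simp: that(4) field_simps power2_eq_square)
  show ?thesis
    unfolding turan_def using assms
    by (intro * DERIV_clifford_at_neg DERIV_clifford_at_neg_Suc DERIV_powr_Suc)
      (auto simp: powr_add)
qed

text \<open>The mixed products of order \<open>\<nu> + 1\<close> cancel, the weight absorbs the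
  terms with factor \<open>\<nu> + 1\<close>, and the product of the two functions of order
  \<open>\<nu>\<close> appears twice. For \<open>\<nu> > -1\<close> the sign of the derivative is
  that of \<open>clifford \<nu> (- t)\<close>.\<close>

lemma DERIV_powr_cross_red:
  assumes "t > 0"
  shows "((\<lambda>t. t powr (\<nu> + 1) * cross_red \<nu> t) has_real_derivative
    2 * t powr \<nu> * clifford \<nu> (- t) * clifford \<nu> t) (at t)"
proof -
  have *: "((\<lambda>t. Z t * (P t * R t + Q t * S t)) has_real_derivative
      2 * w * P t * S t) (at t)"
    if "(P has_real_derivative - Q t) (at t)"
      "(Q has_real_derivative (P t - (\<nu> + 1) * Q t) / t) (at t)"
      "(S has_real_derivative R t) (at t)"
      "(R has_real_derivative (S t - (\<nu> + 1) * R t) / t) (at t)"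
      "(Z has_real_derivative (\<nu> + 1) * w) (at t)" "Z t = w * t" for P Q R S Z w
    using assms
    by (auto intro!: derivative_eq_intros that(1-5)
        simp: that(6) field_simps power2_eq_square)
  have "(clifford (\<nu> + 1) has_real_derivative
      (clifford \<nu> t - (\<nu> + 1) * clifford (\<nu> + 1) t) / t) (at t)"
    using DERIV_clifford[of "\<nu> + 1" t] clifford_rec[of \<nu> t] assms
    by (simp add: add.assoc)
  then show ?thesis
    unfolding cross_red_def using assms
    by (intro * DERIV_clifford_at_neg DERIV_clifford_at_neg_Suc DERIV_clifford DERIV_powr_Suc)
      (auto simp: powr_add)
qed

lemma continuous_on_clifford [continuous_intros]:
  "continuous_on S f \<Longrightarrow> continuous_on S (\<lambda>x. clifford \<nu> (f x))"
  using continuous_on_compose2[of UNIV "clifford \<nu>" S f]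
    DERIV_continuous_on[of UNIV "clifford \<nu>", OF DERIV_subset[OF DERIV_clifford]]
  by auto

lemma continuous_on_dini_red: "continuous_on S (dini_red \<nu>)"
  unfolding dini_red_def by (intro continuous_intros)

lemma continuous_on_cross_red: "continuous_on S (cross_red \<nu>)"
  unfolding cross_red_def by (intro continuous_intros)

text \<open>Since \<open>\<nu> + 1 > 0\<close>, the weighted expression is continuous at 0 with
  value 0, and its derivative is a weighted square.\<close>

lemma turan_pos:
  assumes "\<nu> > -1" "t > 0"
  shows "turan \<nu> t > 0"
proof -
  let ?h = "\<lambda>t. t powr (\<nu> + 1) * turan \<nu> t"
  have cont: "continuous_on {0..x} ?h" for x
    unfolding turan_def using assms by (intro continuous_intros continuous_on_powr') auto
  have "isCont (\<lambda>t. clifford \<nu> (- t)) 0"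
    by (rule DERIV_isCont[OF DERIV_clifford_at_neg])
  moreover have "clifford \<nu> (- 0) > 0"
    using clifford_pos[OF assms(1), of 0] by simp
  ultimately have "\<forall>\<^sub>F t in at 0. clifford \<nu> (- t) > 0"
    by (simp add: isCont_def order_tendstoD(1))
  then obtain d where d: "d > 0" "\<And>t. 0 < t \<Longrightarrow> t < d \<Longrightarrow> clifford \<nu> (- t) > 0"
    by (auto simp: eventually_at dist_real_def)
  \<comment> \<open>Growth is strict on \<open>(0, s)\<close>, where
    \<open>clifford \<nu> (- t)\<close> keeps its positive sign; beyond \<open>s\<close> zeros may
    occur and weak growth is enough.\<close>
  define s where "s = min d t"
  have s: "0 < s" "s \<le> d" "s \<le> t" using d assms by (auto simp: s_def)
  have "?h 0 < ?h s"
  proof (rule DERIV_pos_imp_increasing_open[OF s(1) _ cont])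
    fix x assume x: "0 < x" "x < s"
    then have "clifford \<nu> (- x) > 0" using d s by auto
    then show "\<exists>y. (?h has_real_derivative y) (at x) \<and> y > 0"
      using DERIV_powr_turan[OF x(1), of \<nu>] x by fastforce
  qed
  also have "?h s \<le> ?h t"
  proof (rule DERIV_nonneg_imp_nondecreasing[OF s(3)])
    fix x assume "s \<le> x" "x \<le> t"
    then have x: "x > 0" using s by linarith
    show "\<exists>y. (?h has_real_derivative y) (at x) \<and> y \<ge> 0"
      using DERIV_powr_turan[OF x(1), of \<nu>] by fastforce
  qed
  finally show ?thesis using assms by (simp add: zero_less_mult_iff)
qed

text \<open>At a zero, \<open>turan\<close> reduces to \<open>t\<close> times the square of the
  right-hand value. As that value is minus the derivative, the zeros are simple.\<close>

lemma clifford_zero_simple: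
  assumes "\<nu> > -1" "t > 0" "clifford \<nu> (- t) = 0"
  shows "clifford (\<nu> + 1) (- t) \<noteq> 0"
  using turan_pos[OF assms(1,2)] assms(3) by (auto simp: turan_def)

section \<open>The quotient p, its Riccati equation and the existence of zeros\<close>

text \<open>The function p: minus \<open>t\<close> times the logarithmic derivative of
  \<open>clifford \<nu> (- t)\<close>.\<close>

definition clifford_quot :: "real \<Rightarrow> real \<Rightarrow> real" where
  "clifford_quot \<nu> t = t * clifford (\<nu> + 1) (- t) / clifford \<nu> (- t)"

lemma DERIV_clifford_quot:
  assumes "clifford \<nu> (- t) \<noteq> 0"
  shows "(clifford_quot \<nu> has_real_derivative turan \<nu> t / (clifford \<nu> (- t))\<^sup>2) (at t)"
  unfolding clifford_quot_def
  by (rule DERIV_cong[OF DERIV_divide[OF DERIV_mult_neg_clifford_Suc DERIV_clifford_at_neg assms]])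
    (simp add: turan_def power2_eq_square algebra_simps)

lemma clifford_quot_strict_mono:
  assumes "\<nu> > -1" "0 < x" "x < y" "\<And>t. x \<le> t \<Longrightarrow> t \<le> y \<Longrightarrow> clifford \<nu> (- t) \<noteq> 0"
  shows "clifford_quot \<nu> x < clifford_quot \<nu> y"
proof (rule DERIV_pos_imp_increasing[OF assms(3)])
  fix t assume "x \<le> t" "t \<le> y"
  with assms show "\<exists>d. (clifford_quot \<nu> has_real_derivative d) (at t) \<and> d > 0"
    by (intro exI[of _ "turan \<nu> t / (clifford \<nu> (- t))\<^sup>2"] conjI DERIV_clifford_quot
        divide_pos_pos turan_pos) auto
qed

lemma clifford_quot_riccati:
  assumes "clifford \<nu> (- t) \<noteq> 0" "t > 0"
  shows "(clifford_quot \<nu> has_real_derivative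
    (t - \<nu> * clifford_quot \<nu> t + (clifford_quot \<nu> t)\<^sup>2) / t) (at t)"
  by (rule DERIV_cong[OF DERIV_clifford_quot[OF assms(1)]])
    (use assms in \<open>simp add: turan_def clifford_quot_def power2_eq_square field_simps\<close>)

text \<open>If there were no further zero, the Riccati equation \<open>t p' = t - \<nu> p + p\<^sup>2\<close>
  for \<open>p = clifford_quot \<nu>\<close> would first drive
  \<open>p\<close> to infinity and then, through \<open>t p' \<ge> p\<^sup>2 / 2\<close>, make it blow up at a finite \<open>t\<close>.\<close>

lemma clifford_zeros_unbounded: "\<exists>t>T. clifford \<nu> (- t) = 0"
proof (rule ccontr)
  assume "\<not> ?thesis"
  then have nz: "clifford \<nu> (- t) \<noteq> 0" if "t > T" for t using that by auto
  define p where "p = clifford_quot \<nu>"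
  \<comment> \<open>\<open>A \<ge> \<nu>\<^sup>2 / 2\<close> lets completing the square give
    \<open>t - \<nu> * p t + (p t)\<^sup>2 \<ge> t / 2\<close>, so p has slope at least 1/2 beyond
    \<open>A\<close>.\<close>
  define A where "A = max (\<bar>T\<bar> + 1) (\<nu>\<^sup>2 / 2)"
  have A: "A > T" "A \<ge> 1" "A \<ge> \<nu>\<^sup>2 / 2" unfolding A_def by linarith+
  have deriv: "(p has_real_derivative (t - \<nu> * p t + (p t)\<^sup>2) / t) (at t)" if "t \<ge> A" for t
    unfolding p_def using that A by (intro clifford_quot_riccati nz) auto
  have lower: "p A + (t - A) / 2 \<le> p t" if t: "t \<ge> A" for t
  proof -
    have "(\<lambda>t. p t - t / 2) A \<le> (\<lambda>t. p t - t / 2) t"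
    proof (rule DERIV_nonneg_imp_nondecreasing[OF t])
      fix x assume "A \<le> x" "x \<le> t"
      have "0 \<le> (p x - \<nu> / 2)\<^sup>2" by simp
      then have "x / 2 \<le> x - \<nu> * p x + (p x)\<^sup>2"
        using A \<open>A \<le> x\<close> by (simp add: power2_eq_square algebra_simps)
      then have "(x - \<nu> * p x + (p x)\<^sup>2) / x - 1 / 2 \<ge> 0"
        using A \<open>A \<le> x\<close> by (simp add: field_simps)
      moreover have "((\<lambda>t. p t - t / 2) has_real_derivative
          (x - \<nu> * p x + (p x)\<^sup>2) / x - 1 / 2) (at x)"
        by (auto intro!: derivative_eq_intros deriv \<open>A \<le> x\<close>)
      ultimately show "\<exists>y. ((\<lambda>t. p t - t / 2) has_real_derivative y) (at x) \<and> 0 \<le> y"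
        by blast
    qed
    then show ?thesis by (simp add: field_simps)
  qed
  \<comment> \<open>Chosen so that the linear lower bound exceeds
    \<open>2 * \<bar>\<nu>\<bar>\<close> from \<open>B\<close> on; then \<open>\<nu> * p t\<close>
    is at most half of \<open>(p t)\<^sup>2\<close>.\<close>
  define B where "B = A + 2 * \<bar>p A\<bar> + 4 * \<bar>\<nu>\<bar> + 2"
  have B: "B \<ge> A" unfolding B_def by simp
  have big: "p t \<ge> 2 * \<bar>\<nu>\<bar> \<and> p t \<ge> 1" if "t \<ge> B" for t
  proof -
    have "\<bar>p A\<bar> + 2 * \<bar>\<nu>\<bar> + 1 \<le> (t - A) / 2" using that by (simp add: B_def)
    with lower[OF order_trans[OF B that]] have "2 * \<bar>\<nu>\<bar> + 1 \<le> p t" by linarith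
    then show ?thesis using abs_ge_zero[of \<nu>] by linarith
  qed
  \<comment> \<open>Integrated form of \<open>t p' \<ge> p\<^sup>2 / 2\<close>: the derivative of
    \<open>1 / p\<close> is at most \<open>- 1 / (2 * t)\<close>.\<close>
  let ?h = "\<lambda>t. 1 / p t + ln t / 2"
  have h: "?h t \<le> ?h B" if t: "t \<ge> B" for t
  proof (rule DERIV_nonpos_imp_nonincreasing[OF t])
    fix x assume x: "B \<le> x" "x \<le> t"
    have xp: "x > 0" using x A B by linarith
    have px: "p x > 0" using big[OF x(1)] by linarith
    have "(\<nu> * 2) * p x \<le> p x * p x"
      using big[OF x(1)] by (intro mult_right_mono) linarith+
    then have *: "(p x)\<^sup>2 / 2 \<le> x - \<nu> * p x + (p x)\<^sup>2"
      using xp by (simp add: power2_eq_square algebra_simps)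
    have "- ((x - \<nu> * p x + (p x)\<^sup>2) / x) / (p x)\<^sup>2 + 1 / x / 2 \<le> 0"
      using * xp px by (simp add: field_simps)
    moreover have "(?h has_real_derivative
        - ((x - \<nu> * p x + (p x)\<^sup>2) / x) / (p x)\<^sup>2 + 1 / x / 2) (at x)"
      using px xp deriv[of x] x B
      by (auto intro!: derivative_eq_intros simp: power2_eq_square)
    ultimately show "\<exists>y. (?h has_real_derivative y) (at x) \<and> y \<le> 0" by blast
  qed
  \<comment> \<open>At this \<open>t\<close> the logarithm alone uses up the bound
    \<open>?h B\<close>, leaving no room for the positive term \<open>1 / p t\<close>.\<close>
  define t where "t = max B (exp (2 * ?h B))"
  have "t \<ge> B" by (simp add: t_def)
  have "ln t \<ge> ln (exp (2 * ?h B))"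
    by (rule ln_mono) (auto simp: t_def)
  moreover have "1 / p t > 0" using big[OF \<open>t \<ge> B\<close>] by simp
  ultimately show False using h[OF \<open>t \<ge> B\<close>] by simp
qed

text \<open>The next zero is an infimum of zeros. It stays away from \<open>a\<close> because the
  function is nonzero just to the right of \<open>a\<close>: by continuity if its value at
  \<open>a\<close> is nonzero, by simplicity of the zero otherwise.\<close>

lemma next_clifford_zero:
  assumes "\<nu> > -1" "a \<ge> 0" "a = 0 \<or> clifford \<nu> (- a) = 0"
  shows "\<exists>b>a. clifford \<nu> (- b) = 0 \<and> (\<forall>t. a < t \<and> t < b \<longrightarrow> clifford \<nu> (- t) \<noteq> 0)"
proof -
  have "\<exists>d>0. \<forall>t. a < t \<and> t < a + d \<longrightarrow> clifford \<nu> (- t) \<noteq> 0"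
  proof (cases "clifford \<nu> (- a) = 0")
    case False
    have "isCont (\<lambda>t. clifford \<nu> (- t)) a"
      by (rule DERIV_isCont[OF DERIV_clifford_at_neg])
    then have "\<forall>\<^sub>F t in at a. clifford \<nu> (- t) \<noteq> 0"
      unfolding isCont_def by (rule tendsto_imp_eventually_ne[OF _ False])
    then show ?thesis unfolding eventually_at dist_real_def
      by (metis abs_of_pos add.commute add_less_cancel_left diff_add_cancel diff_gt_0_iff_gt
          less_irrefl UNIV_I)
  next
    case True
    then have "a > 0" using assms clifford_pos[of \<nu> 0] by (cases "a = 0") auto
    then have "- clifford (\<nu> + 1) (- a) \<noteq> 0"
      using clifford_zero_simple True assms(1) by simp
    then consider "- clifford (\<nu> + 1) (- a) > 0" | "- clifford (\<nu> + 1) (- a) < 0"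
      by linarith
    then show ?thesis
    proof cases
      case 1
      from DERIV_pos_inc_right[OF DERIV_clifford_at_neg 1] obtain d where
        "d > 0" "\<And>h. h > 0 \<Longrightarrow> h < d \<Longrightarrow> clifford \<nu> (- a) < clifford \<nu> (- (a + h))" by blast
      from this(1) this(2)[of "t - a" for t] show ?thesis
        using True by (intro exI[of _ d]) fastforce
    next
      case 2
      from DERIV_neg_dec_right[OF DERIV_clifford_at_neg 2] obtain d where
        "d > 0" "\<And>h. h > 0 \<Longrightarrow> h < d \<Longrightarrow> clifford \<nu> (- a) > clifford \<nu> (- (a + h))" by blast
      from this(1) this(2)[of "t - a" for t] show ?thesis
        using True by (intro exI[of _ d]) fastforce
    qed
  qed
  then obtain d where d: "d > 0" "\<And>t. a < t \<Longrightarrow> t < a + d \<Longrightarrow> clifford \<nu> (- t) \<noteq> 0"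
    by blast
  \<comment> \<open>Starting at \<open>a + d\<close> instead of \<open>a\<close> makes the set
    closed and keeps \<open>a\<close> out of it.\<close>
  define Z where "Z = {t. a + d \<le> t} \<inter> {t. clifford \<nu> (- t) = 0}"
  have "closed Z" unfolding Z_def
    by (intro closed_Int closed_Collect_le closed_Collect_eq continuous_intros)
  moreover have "Z \<noteq> {}"
    using clifford_zeros_unbounded[of "a + d" \<nu>] by (auto simp: Z_def intro: less_imp_le)
  moreover have bdd: "bdd_below Z"
    by (rule bdd_belowI[of _ "a + d"]) (auto simp: Z_def)
  ultimately have "Inf Z \<in> Z" by (intro closed_contains_Inf)
  moreover have "clifford \<nu> (- t) \<noteq> 0" if "a < t" "t < Inf Z" for t
    using that d(2)[of t] cInf_lower[OF _ bdd, of t] by (force simp: Z_def)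
  ultimately show ?thesis using d(1) by (intro exI[of _ "Inf Z"]) (auto simp: Z_def)
qed

section \<open>A single gap between consecutive zeros\<close>

lemma nonzero_on_interval_pos:
  fixes f :: "real \<Rightarrow> real"
  assumes "continuous_on {a<..<b} f" "\<And>t. a < t \<Longrightarrow> t < b \<Longrightarrow> f t \<noteq> 0"
    and "a < x" "x < b" "f x > 0" "a < y" "y < b"
  shows "f y > 0"
proof (rule ccontr)
  assume "\<not> f y > 0"
  moreover have "is_interval (f ` {a<..<b})"
    using connected_continuous_image[OF assms(1)] by (simp add: is_interval_connected_1)
  moreover have "f x \<in> f ` {a<..<b}" "f y \<in> f ` {a<..<b}" using assms by auto
  ultimately have "0 \<in> f ` {a<..<b}"
    using assms(5) by (meson linorder_not_less less_imp_le mem_is_interval_1_I)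
  then show False using assms(2) by auto
qed

definition clifford_gap :: "real \<Rightarrow> real \<Rightarrow> real \<Rightarrow> bool" where
  "clifford_gap \<nu> a b \<longleftrightarrow> \<nu> > -1 \<and> 0 \<le> a \<and> a < b \<and>
     (a = 0 \<or> clifford \<nu> (- a) = 0) \<and> clifford \<nu> (- b) = 0 \<and>
     (\<forall>t. a < t \<and> t < b \<longrightarrow> clifford \<nu> (- t) \<noteq> 0)"

text \<open>Endpoint signs and the intermediate value theorem give existence; monotonicity of p and
  of the weighted \<open>cross_red\<close> gives uniqueness. The intervals \<open>(a, b]\<close> are
  half-open so that consecutive gaps tile the positive axis; neither function vanishes at
  \<open>b\<close>.\<close>

lemma clifford_gap_zeros:
  assumes "clifford_gap \<nu> a b"
  shows dini_red_ex1: "\<exists>!x. a < x \<and> x \<le> b \<and> dini_red \<nu> x = 0"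
    and cross_red_nonzero_first: "a = 0 \<Longrightarrow> 0 < t \<Longrightarrow> t \<le> b \<Longrightarrow> cross_red \<nu> t \<noteq> 0"
    and cross_red_ex1: "a > 0 \<Longrightarrow> \<exists>!x. a < x \<and> x \<le> b \<and> cross_red \<nu> x = 0"
    and cross_red_zero_less_dini_red_zero: "a < x \<Longrightarrow> x \<le> b \<Longrightarrow> cross_red \<nu> x = 0 \<Longrightarrow>
      a < y \<Longrightarrow> y \<le> b \<Longrightarrow> dini_red \<nu> y = 0 \<Longrightarrow> x < y"
proof -
  have order: "\<nu> > -1" and gap: "0 \<le> a" "a < b"
    and zero_left: "a = 0 \<or> clifford \<nu> (- a) = 0" and zero_right: "clifford \<nu> (- b) = 0"
    using assms by (auto simp: clifford_gap_def)
  have nonzero: "clifford \<nu> (- t) \<noteq> 0" if "a < t" "t < b" for t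
    using assms that by (auto simp: clifford_gap_def)
  \<comment> \<open>Multiplying by the sign at the midpoint treats gaps of both signs at
    once.\<close>
  define sg where "sg = sgn (clifford \<nu> (- ((a + b) / 2)))"
  have sg_pos: "sg * clifford \<nu> (- t) > 0" if hyp: "a < t" "t < b" for t
  proof (rule nonzero_on_interval_pos[of a b "\<lambda>t. sg * clifford \<nu> (- t)" "(a + b) / 2"])
    show "continuous_on {a<..<b} (\<lambda>t. sg * clifford \<nu> (- t))" by (intro continuous_intros)
    have m: "a < (a + b) / 2" "(a + b) / 2 < b" using gap by auto
    then show "sg * clifford \<nu> (- ((a + b) / 2)) > 0"
      using nonzero[OF m] by (simp add: sg_def sgn_mult_self_eq abs_sgn[symmetric] mult.commute)
    show "sg * clifford \<nu> (- t) \<noteq> 0" if "a < t" "t < b" for t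
      using nonzero[OF that] nonzero[OF m] by (simp add: sg_def sgn_eq_0_iff)
  qed (use gap hyp in auto)
  have DERIV_sg: "((\<lambda>t. sg * clifford \<nu> (- t)) has_real_derivative
      - (sg * clifford (\<nu> + 1) (- t))) (at t)" for t
    using DERIV_cmult[OF DERIV_clifford_at_neg, of sg] by simp
  have sg_nonzero: "sg \<noteq> 0"
    using sg_pos[of "(a + b) / 2"] gap by auto
  \<comment> \<open>A function positive before \<open>b\<close> and zero at \<open>b\<close> cannot
    have positive derivative there, and simplicity excludes derivative 0.\<close>
  have slope_right: "sg * clifford (\<nu> + 1) (- b) > 0"
  proof (rule ccontr)
    assume "\<not> ?thesis"
    moreover have "clifford (\<nu> + 1) (- b) \<noteq> 0"
      using gap by (intro clifford_zero_simple order zero_right) auto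
    ultimately have "- (sg * clifford (\<nu> + 1) (- b)) > 0"
      using sg_nonzero by (metis linorder_neqE_linordered_idom mult_eq_0_iff neg_0_less_iff_less)
    from DERIV_pos_inc_left[OF DERIV_sg this] obtain d where d: "d > 0"
      "\<And>h. h > 0 \<Longrightarrow> h < d \<Longrightarrow> sg * clifford \<nu> (- (b - h)) < sg * clifford \<nu> (- b)" by blast
    define h where "h = min d (b - a) / 2"
    have h: "h > 0" "h < d" "a < b - h" using d gap by (auto simp: h_def min_def field_simps)
    show False
      using d(2)[OF h(1,2)] sg_pos[of "b - h"] h zero_right by simp
  qed
  have slope_left: "sg * clifford (\<nu> + 1) (- a) < 0" if hyp: "a > 0"
  proof (rule ccontr)
    assume "\<not> ?thesis"
    moreover have zero: "clifford \<nu> (- a) = 0" using zero_left hyp by auto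
    then have "clifford (\<nu> + 1) (- a) \<noteq> 0"
      using hyp by (intro clifford_zero_simple order) auto
    ultimately have "- (sg * clifford (\<nu> + 1) (- a)) < 0"
      using sg_nonzero by (metis linorder_neqE_linordered_idom mult_eq_0_iff neg_less_0_iff_less)
    from DERIV_neg_dec_right[OF DERIV_sg this] obtain d where d: "d > 0"
      "\<And>h. h > 0 \<Longrightarrow> h < d \<Longrightarrow> sg * clifford \<nu> (- a) > sg * clifford \<nu> (- (a + h))" by blast
    define h where "h = min d (b - a) / 2"
    have h: "h > 0" "h < d" "a + h < b" using d gap by (auto simp: h_def min_def field_simps)
    show False
      using d(2)[OF h(1,2)] sg_pos[of "a + h"] h zero by simp
  qed
  have sg_at_0: "sg * clifford \<nu> 0 > 0" if hyp: "a = 0"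
  proof -
    have "sg * clifford \<nu> (- a) \<ge> 0"
    proof (rule ccontr)
      assume neg: "\<not> ?thesis"
      let ?m = "(a + b) / 2"
      have "\<exists>x. a \<le> x \<and> x \<le> ?m \<and> sg * clifford \<nu> (- x) = 0"
      proof (rule IVT')
        show "sg * clifford \<nu> (- a) \<le> 0" using neg by simp
        show "0 \<le> sg * clifford \<nu> (- ?m)" "a \<le> ?m" using sg_pos[of ?m] gap by simp_all
      qed (intro continuous_intros)
      then obtain x where x: "a \<le> x" "x \<le> ?m" "sg * clifford \<nu> (- x) = 0" by blast
      then have "x \<noteq> a" using neg by auto
      with x show False using sg_pos[of x] gap by auto
    qed
    then show ?thesis
      using hyp sg_nonzero clifford_pos[OF order, of 0]
      by (auto simp: zero_le_mult_iff zero_less_mult_iff)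
  qed
  \<comment> \<open>At a zero of \<open>clifford \<nu> (- t)\<close>, \<open>dini_red\<close> is
    \<open>- 2 * t * clifford (\<nu> + 1) (- t)\<close>, so the slopes determine its sign.\<close>
  have dini_red_right: "sg * dini_red \<nu> b < 0"
    using slope_right gap zero_right
    by (simp add: dini_red_def zero_less_mult_iff mult_less_0_iff)
  have dini_red_left: "sg * dini_red \<nu> a > 0"
  proof (cases "a = 0")
    case True
    then show ?thesis using sg_at_0 by (simp add: dini_red_def)
  next
    case False
    then show ?thesis using slope_left zero_left gap
      by (simp add: dini_red_def zero_less_mult_iff mult_less_0_iff)
  qed
  have dini_red_eq_0_iff: "dini_red \<nu> t = 0 \<longleftrightarrow> clifford_quot \<nu> t = 1 / 2"
    if hyp: "a < t" "t < b" for t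
    using nonzero[OF hyp] by (auto simp: dini_red_def clifford_quot_def field_simps)
  have dini_red_ex1: "\<exists>!x. a < x \<and> x \<le> b \<and> dini_red \<nu> x = 0"
  proof -
    have "\<exists>x. a \<le> x \<and> x \<le> b \<and> sg * dini_red \<nu> x = 0"
      using dini_red_left dini_red_right gap
      by (intro IVT2' continuous_on_mult_left continuous_on_dini_red less_imp_le)
    then obtain x where x: "a \<le> x" "x \<le> b" "dini_red \<nu> x = 0" using sg_nonzero by auto
    then have "a < x" "x < b" using dini_red_left dini_red_right by (auto simp: le_less)
    moreover have "y = x" if "a < y" "y \<le> b" "dini_red \<nu> y = 0" for y
    proof -
      have "y < b" using that dini_red_right by (auto simp: le_less)
      have "clifford_quot \<nu> y = clifford_quot \<nu> x"
        using that x \<open>a < x\<close> \<open>x < b\<close> \<open>y < b\<close> dini_red_eq_0_iff by auto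
      then show ?thesis
        using clifford_quot_strict_mono[OF order, of x y]
          clifford_quot_strict_mono[OF order, of y x]
          nonzero gap \<open>a < x\<close> \<open>x < b\<close> \<open>y < b\<close> \<open>a < y\<close>
        by (cases x y rule: linorder_cases) force+
    qed
    ultimately show ?thesis using x by blast
  qed
  have powr_cross_red_strict_mono: "x powr (\<nu> + 1) * (sg * cross_red \<nu> x) <
      y powr (\<nu> + 1) * (sg * cross_red \<nu> y)" if hyp: "a \<le> x" "x < y" "y \<le> b" for x y
  proof (rule DERIV_pos_imp_increasing_open[OF hyp(2)])
    show "continuous_on {x..y} (\<lambda>t. t powr (\<nu> + 1) * (sg * cross_red \<nu> t))"
      using order hyp(1) gap(1)
      by (intro continuous_on_mult continuous_on_mult_left continuous_on_cross_red
          continuous_on_powr' continuous_on_id continuous_on_const) simp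
  next
    fix t assume "x < t" "t < y"
    then have t: "a < t" "t < b" "t > 0" using hyp gap by auto
    have "((\<lambda>t. t powr (\<nu> + 1) * (sg * cross_red \<nu> t)) has_real_derivative
        2 * t powr \<nu> * (sg * clifford \<nu> (- t)) * clifford \<nu> t) (at t)"
      using DERIV_cmult[OF DERIV_powr_cross_red[OF t(3), of \<nu>], of sg] by (simp add: mult_ac)
    moreover have "2 * t powr \<nu> * (sg * clifford \<nu> (- t)) * clifford \<nu> t > 0"
      using t by (intro mult_pos_pos[of "_ * _"] mult_pos_pos[of "2 * _"] sg_pos
          clifford_pos order) auto
    ultimately show "\<exists>d. ((\<lambda>t. t powr (\<nu> + 1) * (sg * cross_red \<nu> t)) has_real_derivative d) (at t)
        \<and> d > 0" by blast
  qed
  \<comment> \<open>At a zero of \<open>clifford \<nu> (- t)\<close> only the second product of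
    \<open>cross_red\<close> survives, and \<open>clifford \<nu> t\<close> is positive.\<close>
  have cross_red_right: "sg * cross_red \<nu> b > 0"
    using slope_right zero_right mult_pos_pos[OF slope_right clifford_pos[OF order, of b]] gap
    by (simp add: cross_red_def mult.assoc)
  have cross_red_left: "sg * cross_red \<nu> a < 0" if hyp: "a > 0"
    using slope_left[OF hyp] zero_left mult_neg_pos[OF slope_left clifford_pos[OF order, of a]] hyp
    by (simp add: cross_red_def mult.assoc)
  \<comment> \<open>The weighted function starts from 0 at the origin and increases
    strictly.\<close>
  have cross_red_nonzero_first: "cross_red \<nu> t \<noteq> 0" if hyp: "a = 0" "0 < t" "t \<le> b" for t
    using powr_cross_red_strict_mono[of 0 t] hyp order by auto
  have cross_red_ex1: "\<exists>!x. a < x \<and> x \<le> b \<and> cross_red \<nu> x = 0" if hyp: "a > 0"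
  proof -
    have "\<exists>x. a \<le> x \<and> x \<le> b \<and> sg * cross_red \<nu> x = 0"
      using cross_red_left[OF hyp] cross_red_right gap
      by (intro IVT' continuous_on_mult_left continuous_on_cross_red less_imp_le)
    then obtain x where x: "a \<le> x" "x \<le> b" "cross_red \<nu> x = 0" using sg_nonzero by auto
    then have "a < x" using cross_red_left[OF hyp] by (auto simp: le_less)
    moreover have "y = x" if "a < y" "y \<le> b" "cross_red \<nu> y = 0" for y
      using powr_cross_red_strict_mono[of x y] powr_cross_red_strict_mono[of y x] that x
      by (cases x y rule: linorder_cases) auto
    ultimately show ?thesis using x by blast
  qed
  have cross_red_zero_less_dini_red_zero: "x < y"
    if hyp: "a < x" "x \<le> b" "cross_red \<nu> x = 0" "a < y" "y \<le> b" "dini_red \<nu> y = 0" for x y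
  proof -
    have "x < b" using cross_red_right hyp(2,3) by (auto simp: le_less)
    have "y < b" using dini_red_right hyp(5,6) by (auto simp: le_less)
    have nz: "clifford \<nu> (- x) \<noteq> 0" using nonzero hyp \<open>x < b\<close> by auto
    have "x > 0" using hyp(1) gap by linarith
    then have pos: "x > 0" "clifford \<nu> x > 0" "clifford (\<nu> + 1) x > 0"
      using order by (simp_all add: clifford_pos)
    \<comment> \<open>A zero of \<open>cross_red\<close> ties p to the corresponding quotient at the
      positive argument, with opposite sign. So p is negative at \<open>x\<close> but 1/2 at
      \<open>y\<close>.\<close>
    have "clifford_quot \<nu> x = - (x * clifford (\<nu> + 1) x / clifford \<nu> x)"
    proof -
      have "clifford (\<nu> + 1) (- x) * clifford \<nu> x = - (clifford (\<nu> + 1) x * clifford \<nu> (- x))"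
        using hyp(3) by (simp add: cross_red_def mult.commute)
      then have "clifford (\<nu> + 1) (- x) / clifford \<nu> (- x) = - (clifford (\<nu> + 1) x / clifford \<nu> x)"
        using nz pos by (simp add: field_simps)
      then show ?thesis unfolding clifford_quot_def
        by (metis mult_minus_right times_divide_eq_right)
    qed
    also have "\<dots> < 0" using pos by simp
    also have "0 < clifford_quot \<nu> y"
      using dini_red_eq_0_iff hyp \<open>y < b\<close> by simp
    finally have "clifford_quot \<nu> x < clifford_quot \<nu> y" .
    then show ?thesis
      using clifford_quot_strict_mono[OF order, of y x] nonzero gap hyp \<open>x < b\<close> \<open>y < b\<close>
      by (cases x y rule: linorder_cases) force+
  qed
  show "\<exists>!x. a < x \<and> x \<le> b \<and> dini_red \<nu> x = 0"
    by (fact dini_red_ex1)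
  show "a = 0 \<Longrightarrow> 0 < t \<Longrightarrow> t \<le> b \<Longrightarrow> cross_red \<nu> t \<noteq> 0"
    by (fact cross_red_nonzero_first)
  show "a > 0 \<Longrightarrow> \<exists>!x. a < x \<and> x \<le> b \<and> cross_red \<nu> x = 0"
    by (fact cross_red_ex1)
  show "a < x \<Longrightarrow> x \<le> b \<Longrightarrow> cross_red \<nu> x = 0 \<Longrightarrow>
      a < y \<Longrightarrow> y \<le> b \<Longrightarrow> dini_red \<nu> y = 0 \<Longrightarrow> x < y"
    by (fact cross_red_zero_less_dini_red_zero)
qed

section \<open>Enumeration of the gaps\<close>

text \<open>Iterating the step to the next zero from 0 exhausts the positive axis: a finite limit
  would be an accumulation point of zeros, hence a multiple zero.\<close>

lemma clifford_zero_sequence: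
  assumes "\<nu> > -1"
  obtains b :: "nat \<Rightarrow> real" where "b 0 = 0" "\<And>n. clifford_gap \<nu> (b n) (b (Suc n))"
    "\<And>t. t > 0 \<Longrightarrow> \<exists>n. b n < t \<and> t \<le> b (Suc n)"
proof -
  define good where "good a \<longleftrightarrow> a \<ge> 0 \<and> (a = 0 \<or> clifford \<nu> (- a) = 0)" for a
  have "\<exists>b. good b \<and> a < b \<and> clifford \<nu> (- b) = 0 \<and>
      (\<forall>t. a < t \<and> t < b \<longrightarrow> clifford \<nu> (- t) \<noteq> 0)" if "good a" for a
    using next_clifford_zero[OF assms, of a] that
    unfolding good_def by (meson less_imp_le order_trans)
  then obtain nx where nx: "\<And>a. good a \<Longrightarrow> good (nx a) \<and> a < nx a \<and> clifford \<nu> (- nx a) = 0 \<and>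
      (\<forall>t. a < t \<and> t < nx a \<longrightarrow> clifford \<nu> (- t) \<noteq> 0)"
    by metis
  define b where "b n = (nx ^^ n) 0" for n
  have "good (b n)" for n
    by (induction n) (use nx in \<open>auto simp: b_def good_def[of 0]\<close>)
  then have b: "b 0 = 0" "\<And>n. good (b n)"
    "\<And>n. b n < b (Suc n) \<and> clifford \<nu> (- b (Suc n)) = 0 \<and>
      (\<forall>t. b n < t \<and> t < b (Suc n) \<longrightarrow> clifford \<nu> (- t) \<noteq> 0)"
    using nx by (auto simp: b_def)
  have gap: "clifford_gap \<nu> (b n) (b (Suc n))" for n
    using b(2)[of n] b(3)[of n] assms by (auto simp: good_def clifford_gap_def)
  have mono: "strict_mono b" using b(3) by (simp add: strict_mono_Suc_iff)
  have unbounded: "\<exists>n. t \<le> b n" for t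
  proof (rule ccontr)
    assume "\<not> ?thesis"
    then have le: "b n \<le> t" for n by (meson linear)
    have "\<exists>L. b \<longlonglongrightarrow> L \<and> (\<forall>n. b n \<le> L)"
      using incseq_convergent[of b t] strict_mono_mono[OF mono] le by metis
    then obtain L where L: "b \<longlonglongrightarrow> L" "\<And>n. b n \<le> L" by blast
    have "clifford \<nu> (- L) = 0"
    proof (rule LIMSEQ_unique)
      show "(\<lambda>n. clifford \<nu> (- b (Suc n))) \<longlonglongrightarrow> clifford \<nu> (- L)"
        by (rule isCont_tendsto_compose[OF DERIV_isCont[OF DERIV_clifford]])
          (intro tendsto_minus LIMSEQ_Suc L)
      show "(\<lambda>n. clifford \<nu> (- b (Suc n))) \<longlonglongrightarrow> 0" using b(3) by simp
    qed
    moreover have "L > 0" using L(2)[of 1] b(1) b(3)[of 0] by simp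
    ultimately have "clifford (\<nu> + 1) (- L) \<noteq> 0"
      using clifford_zero_simple assms by blast
    moreover have "((\<lambda>t. clifford \<nu> (- t)) has_real_derivative - clifford (\<nu> + 1) (- L)) (at L)"
      by (rule DERIV_clifford_at_neg)
    then have "((\<lambda>t. (clifford \<nu> (- t) - clifford \<nu> (- L)) / (t - L)) \<longlongrightarrow>
        - clifford (\<nu> + 1) (- L)) (at L)"
      by (simp add: has_field_derivative_iff)
    then have "(\<lambda>n. (clifford \<nu> (- b (Suc n)) - clifford \<nu> (- L)) / (b (Suc n) - L))
        \<longlonglongrightarrow> - clifford (\<nu> + 1) (- L)"
    proof (rule filterlim_compose)
      have "b (Suc n) \<noteq> L" for n
        using L(2)[of "Suc (Suc n)"] b(3)[of "Suc n"] by auto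
      then show "filterlim (\<lambda>n. b (Suc n)) (at L) sequentially"
        by (simp add: filterlim_at LIMSEQ_Suc L)
    qed
    \<comment> \<open>Numerators vanish at zeros, so every difference quotient along the sequence is
      0.\<close>
    then have "(\<lambda>n. 0) \<longlonglongrightarrow> - clifford (\<nu> + 1) (- L)"
      using b(3) \<open>clifford \<nu> (- L) = 0\<close> by simp
    ultimately show False by (simp add: LIMSEQ_const_iff)
  qed
  have "\<exists>n. b n < t \<and> t \<le> b (Suc n)" if tpos: "t > 0" for t
  proof -
    define N where "N = (LEAST n. t \<le> b n)"
    have N: "t \<le> b N" unfolding N_def using unbounded by (meson LeastI_ex)
    then obtain n where n: "N = Suc n" using b(1) tpos by (cases N) auto
    then have "\<not> t \<le> b n" using not_less_Least[of n "\<lambda>n. t \<le> b n"] by (simp add: N_def)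
    then show ?thesis using N n by (intro exI[of _ n]) simp
  qed
  then show ?thesis using that b(1) gap by blast
qed

section \<open>Numbering the positive zeros and interlacing them\<close>

text \<open>Exactly \<open>a 0\<close>, ..., \<open>a m\<close> lie in \<open>(0, a m]\<close>;
  enumeration from 0 against counting from 1 accounts for \<open>Suc\<close>.\<close>

lemma pos_zero_eq:
  fixes a :: "nat \<Rightarrow> real"
  assumes "strict_mono a" "\<And>n. a n > 0" "\<And>x. x > 0 \<Longrightarrow> f x = 0 \<longleftrightarrow> x \<in> range a"
  shows "pos_zero f (Suc n) = a n"
proof -
  have eq: "{y. 0 < y \<and> y \<le> a m \<and> f y = 0} = a ` {..m}" for m
    using assms(2,3) by (force simp: strict_mono_less_eq[OF assms(1)])
  have card: "card (a ` {..m}) = Suc m" for m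
    using strict_mono_imp_inj_on[OF assms(1)] by (simp add: card_image inj_on_subset)
  show ?thesis unfolding pos_zero_def
  proof (rule the_equality)
    show "0 < a n \<and> f (a n) = 0 \<and> finite {y. 0 < y \<and> y \<le> a n \<and> f y = 0} \<and>
        card {y. 0 < y \<and> y \<le> a n \<and> f y = 0} = Suc n"
      using assms(2,3) by (simp add: eq card)
  next
    fix x assume x: "0 < x \<and> f x = 0 \<and> finite {y. 0 < y \<and> y \<le> x \<and> f y = 0} \<and>
        card {y. 0 < y \<and> y \<le> x \<and> f y = 0} = Suc n"
    then obtain m where "x = a m" using assms(3) by auto
    with x show "x = a n" by (simp add: eq card)
  qed
qed

text \<open>The map z^2/4 is an increasing bijection of the positive axis with inverse
  \<open>2 * sqrt t\<close>, so it preserves the rank of a zero.\<close>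

lemma pos_zero_sq_subst:
  fixes a :: "nat \<Rightarrow> real"
  assumes "strict_mono a" "\<And>n. a n > 0" "\<And>t. t > 0 \<Longrightarrow> g t = 0 \<longleftrightarrow> t \<in> range a"
    and "\<And>z. z > 0 \<Longrightarrow> f z = 0 \<longleftrightarrow> g (z\<^sup>2 / 4) = 0"
  shows "pos_zero f (Suc n) = 2 * sqrt (a n)"
proof (rule pos_zero_eq)
  show "strict_mono (\<lambda>n. 2 * sqrt (a n))"
    using assms(1) by (simp add: strict_mono_def)
  fix z :: real assume z: "z > 0"
  have "z\<^sup>2 / 4 = a n \<longleftrightarrow> z = 2 * sqrt (a n)" for n
  proof
    assume "z\<^sup>2 / 4 = a n"
    then have "sqrt (a n) = sqrt ((z / 2)\<^sup>2)" by (simp add: power_divide)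
    then show "z = 2 * sqrt (a n)" using z by simp
  next
    assume "z = 2 * sqrt (a n)"
    then show "z\<^sup>2 / 4 = a n" using less_imp_le[OF assms(2)[of n]] by (simp add: power_mult_distrib)
  qed
  moreover have "z\<^sup>2 / 4 > 0" using z by simp
  ultimately show "f z = 0 \<longleftrightarrow> z \<in> range (\<lambda>n. 2 * sqrt (a n))"
    unfolding assms(4)[OF z] assms(3)[OF \<open>z\<^sup>2 / 4 > 0\<close>] by auto
qed (use assms in auto)

theorem theorem2:
  fixes \<nu> :: real and n :: nat
  assumes "\<nu> > -1" and "n \<ge> 1"
  shows "pos_zero (dini \<nu>) n < pos_zero (cross_W \<nu>) n \<and>
         pos_zero (cross_W \<nu>) n < pos_zero (dini \<nu>) (n + 1)"
proof -
  obtain b where b0: "b 0 = 0" and gap: "\<And>n. clifford_gap \<nu> (b n) (b (Suc n))"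
    and cover: "\<And>t. t > 0 \<Longrightarrow> \<exists>n. b n < t \<and> t \<le> b (Suc n)"
    using clifford_zero_sequence[OF assms(1)] by blast
  have b_nonneg: "b n \<ge> 0" for n
    using gap[of n] by (simp add: clifford_gap_def)
  have b_pos: "b (Suc n) > 0" for n
    using gap[of n] by (simp add: clifford_gap_def)
  have "\<exists>\<alpha>. \<forall>n. b n < \<alpha> n \<and> \<alpha> n \<le> b (Suc n) \<and> dini_red \<nu> (\<alpha> n) = 0"
    using dini_red_ex1[OF gap] by (intro choice allI) blast
  then obtain \<alpha> where \<alpha>: "\<And>n. b n < \<alpha> n" "\<And>n. \<alpha> n \<le> b (Suc n)" "\<And>n. dini_red \<nu> (\<alpha> n) = 0"
    by blast
  \<comment> \<open>The first gap has no zero of \<open>cross_red\<close>, so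
    \<open>\<gamma> n\<close> lies in the gap after that of \<open>\<alpha> n\<close>, together with
    \<open>\<alpha> (Suc n)\<close>.\<close>
  have "\<exists>\<gamma>. \<forall>n. b (Suc n) < \<gamma> n \<and> \<gamma> n \<le> b (Suc (Suc n)) \<and> cross_red \<nu> (\<gamma> n) = 0"
    using cross_red_ex1[OF gap b_pos] by (intro choice allI) blast
  then obtain \<gamma> where \<gamma>: "\<And>n. b (Suc n) < \<gamma> n" "\<And>n. \<gamma> n \<le> b (Suc (Suc n))"
      "\<And>n. cross_red \<nu> (\<gamma> n) = 0"
    by blast
  have dini_zeros: "dini_red \<nu> t = 0 \<longleftrightarrow> t \<in> range \<alpha>" if tpos: "t > 0" for t
  proof
    assume t: "dini_red \<nu> t = 0"
    obtain k where "b k < t" "t \<le> b (Suc k)" using cover[OF tpos] by blast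
    then have "t = \<alpha> k"
      using dini_red_ex1[OF gap, of k] t \<alpha>[of k] by blast
    then show "t \<in> range \<alpha>" by simp
  qed (use \<alpha> in auto)
  have cross_zeros: "cross_red \<nu> t = 0 \<longleftrightarrow> t \<in> range \<gamma>" if tpos: "t > 0" for t
  proof
    assume t: "cross_red \<nu> t = 0"
    obtain m where m: "b m < t" "t \<le> b (Suc m)" using cover[OF tpos] by blast
    then obtain k where k: "m = Suc k"
      using cross_red_nonzero_first[OF gap, of 0] b0 tpos t by (cases m) auto
    have "t = \<gamma> k"
      using cross_red_ex1[OF gap b_pos, of k] m t \<gamma>[of k] unfolding k by blast
    then show "t \<in> range \<gamma>" by simp
  qed (use \<gamma> in auto)
  have pos_\<alpha>: "\<alpha> n > 0" and pos_\<gamma>: "\<gamma> n > 0" for n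
    using \<alpha>(1) \<gamma>(1) b_nonneg by (auto intro: le_less_trans)
  have "strict_mono \<alpha>" "strict_mono \<gamma>"
    unfolding strict_mono_Suc_iff
    by (intro allI le_less_trans[OF \<alpha>(2) \<alpha>(1)] le_less_trans[OF \<gamma>(2) \<gamma>(1)])+
  then have "pos_zero (dini \<nu>) (Suc m) = 2 * sqrt (\<alpha> m)"
    and "pos_zero (cross_W \<nu>) (Suc m) = 2 * sqrt (\<gamma> m)" for m
    using pos_zero_sq_subst[OF _ pos_\<alpha> dini_zeros dini_eq_0_iff]
      pos_zero_sq_subst[OF _ pos_\<gamma> cross_zeros cross_W_eq_0_iff] by blast+
  moreover have "\<alpha> m < \<gamma> m" for m
    \<comment> \<open>The common endpoint \<open>b (Suc m)\<close> of the two gaps separates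
      them.\<close>
    using \<alpha>(2) \<gamma>(1) by (rule le_less_trans)
  moreover have "\<gamma> m < \<alpha> (Suc m)" for m
    using cross_red_zero_less_dini_red_zero[OF gap \<gamma> \<alpha>] .
  moreover obtain m where "n = Suc m" using assms(2) by (cases n) auto
  ultimately show ?thesis by simp
qed

end
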